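(* Let $X$ be a three-point subset of the unit sphere $\mathbb{S}^2\subset\mathbb{R}^3$. (i) If the affine span of $X$ does not contain the origin, then $X$ is spherical sub-$p$-toral for all sufficiently large primes $p$. (ii) Suppose $X$ lies on the great circle $\mathbb{S}^1=\mathbb{S}^2\cap(\mathbb{R}^2\times\{0\})$. Then $X$ is spherical sub-$p$-toral for some prime $p$ if and only if either $X$ is the vertex set of a right-angled triangle, or there is a prime $p$ such that $X$ is contained in a single orbit of the standard action of $\mathbb{Z}_p$ on $\mathbb{S}^1$ (generated by rotation by angle $2\pi/p$).
   Context: A $p$-torus is a group $G\cong(\mathbb{Z}_p)^\alpha$, $\alpha\ge1$. A set $X\subset\mathbb{S}^{k-1}$ (unit sphere of $\mathbb{R}^k$) is spherical sub-$p$-toral if there exist $n\ge k$, a $p$-torus $G$ and an orthogonal linear action of $G$ on $\mathbb{R}^n$ such that $X$, viewed in $\mathbb{S}^{n-1}$ via the standard inclusion $\mathbb{R}^k\subset\mathbb{R}^n$, is contained in a single $G$-orbit. *)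

theory Defs
  imports "HOL-Analysis.Analysis" "HOL-Computational_Algebra.Primes"
begin

text \<open>Vectors of R^n are represented as functions nat => real vanishing at indices >= n;
  n x n matrices as functions nat => nat => real (only entries with indices < n matter).\<close>

definition in_Rn :: "nat \<Rightarrow> (nat \<Rightarrow> real) \<Rightarrow> bool" where
  "in_Rn n x \<longleftrightarrow> (\<forall>i\<ge>n. x i = 0)"

definition unit_sphere_n :: "nat \<Rightarrow> (nat \<Rightarrow> real) set" where
  "unit_sphere_n n = {x. in_Rn n x \<and> (\<Sum>i<n. (x i)\<^sup>2) = 1}"

definition mat_app :: "nat \<Rightarrow> (nat \<Rightarrow> nat \<Rightarrow> real) \<Rightarrow> (nat \<Rightarrow> real) \<Rightarrow> (nat \<Rightarrow> real)" where
  "mat_app n M x = (\<lambda>i. if i < n then (\<Sum>j<n. M i j * x j) else 0)"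

definition orthogonal_n :: "nat \<Rightarrow> (nat \<Rightarrow> nat \<Rightarrow> real) \<Rightarrow> bool" where
  "orthogonal_n n M \<longleftrightarrow>
     (\<forall>i<n. \<forall>j<n. (\<Sum>l<n. M l i * M l j) = (if i = j then 1 else 0))"

text \<open>The p-torus (Z_p)^alpha: tuples (g_0,...,g_{alpha-1}) with 0 <= g_i < p, stored as
  functions nat => nat vanishing from index alpha on; group operation = componentwise addition mod p.\<close>

definition ptorus :: "nat \<Rightarrow> nat \<Rightarrow> (nat \<Rightarrow> nat) set" where
  "ptorus p \<alpha> = {g. \<forall>i. (i < \<alpha> \<longrightarrow> g i < p) \<and> (\<alpha> \<le> i \<longrightarrow> g i = 0)}"

definition ptorus_add :: "nat \<Rightarrow> (nat \<Rightarrow> nat) \<Rightarrow> (nat \<Rightarrow> nat) \<Rightarrow> (nat \<Rightarrow> nat)" where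
  "ptorus_add p g h = (\<lambda>i. (g i + h i) mod p)"

definition orth_action :: "nat \<Rightarrow> nat \<Rightarrow> nat \<Rightarrow> ((nat \<Rightarrow> nat) \<Rightarrow> nat \<Rightarrow> nat \<Rightarrow> real) \<Rightarrow> bool" where
  "orth_action p \<alpha> n \<rho> \<longleftrightarrow>
     (\<forall>g\<in>ptorus p \<alpha>. orthogonal_n n (\<rho> g)) \<and>
     (\<forall>g\<in>ptorus p \<alpha>. \<forall>h\<in>ptorus p \<alpha>. \<forall>i<n. \<forall>j<n.
        \<rho> (ptorus_add p g h) i j = (\<Sum>l<n. \<rho> g i l * \<rho> h l j))"

definition orbit_n :: "nat \<Rightarrow> nat \<Rightarrow> nat \<Rightarrow> ((nat \<Rightarrow> nat) \<Rightarrow> nat \<Rightarrow> nat \<Rightarrow> real) \<Rightarrow> (nat \<Rightarrow> real) \<Rightarrow> (nat \<Rightarrow> real) set" where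
  "orbit_n p \<alpha> n \<rho> v = (\<lambda>g. mat_app n (\<rho> g) v) ` ptorus p \<alpha>"

text \<open>X (a subset of S^{k-1}, viewed inside S^{n-1}) is spherical sub-p-toral.\<close>

definition spherical_sub_p_toral :: "nat \<Rightarrow> nat \<Rightarrow> (nat \<Rightarrow> real) set \<Rightarrow> bool" where
  "spherical_sub_p_toral p k X \<longleftrightarrow>
     (\<exists>n \<ge> k. \<exists>\<alpha> \<ge> 1. \<exists>\<rho>. orth_action p \<alpha> n \<rho> \<and>
        (\<exists>v \<in> unit_sphere_n n. X \<subseteq> orbit_n p \<alpha> n \<rho> v))"

definition emb3 :: "real^3 \<Rightarrow> (nat \<Rightarrow> real)" where
  "emb3 x = (\<lambda>i. if i = 0 then x$1 else if i = 1 then x$2 else if i = 2 then x$3 else 0)"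

definition rot3 :: "nat \<Rightarrow> nat \<Rightarrow> real^3 \<Rightarrow> real^3" where
  "rot3 p k x = (let t = 2 * pi * real k / real p in
     vector [cos t * x$1 - sin t * x$2, sin t * x$1 + cos t * x$2, x$3])"

definition right_angled_triangle :: "(real^3) set \<Rightarrow> bool" where
  "right_angled_triangle X \<longleftrightarrow>
     (\<exists>a b c. X = {a, b, c} \<and> a \<noteq> b \<and> b \<noteq> c \<and> a \<noteq> c \<and> (b - a) \<bullet> (c - a) = 0)"

end

theory Submission
  imports Defs
begin

text \<open>
  Decomposing an orthogonal representation of a \<open>p\<close>-torus into characters shows that unit vectors
  \<open>x, y, z\<close> lie in one orbit, up to an isometry of a larger space, as soon as
  \<open>(x \<bullet> y, y \<bullet> z, x \<bullet> z)\<close> is a convex combination of triples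
  \<open>(cos \<theta>, cos \<phi>, cos (\<theta> + \<phi>))\<close> with \<open>\<theta>\<close>, \<open>\<phi>\<close> multiples of \<open>2 \<pi> / p\<close>.
  Over all real angles these triples have the elliptope of \<open>3 \<times> 3\<close> correlation matrices as convex
  hull. If \<open>0\<close> is not in the affine span, the Gram triple is interior to the elliptope, hence in the
  convex hull of the discrete triples once \<open>p\<close> is large. A right angle places the triple on a
  face of the tetrahedron spanned by the discrete triples for \<open>p = 2\<close>.

  Conversely, three points of a great circle satisfy a linear relation
  \<open>l x + m y + r z = 0\<close>. It is preserved by the group, so a Fourier transform along the orbit gives
  \<open>p\<close>-th roots of unity \<open>u\<close>, \<open>w\<close> with \<open>l + m u + r w = 0\<close>. If no coefficient vanishes, a triangle with
  sides \<open>|l|, |m|, |r|\<close> is rigid, so \<open>y / x\<close> and \<open>z / x\<close> are \<open>u\<close> and \<open>w\<close> up to a common conjugation;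
  if one vanishes, two of the points are antipodal and the triangle is right-angled.
\<close>

section \<open>Moving a configuration by reflections\<close>

definition ip :: "nat \<Rightarrow> (nat \<Rightarrow> real) \<Rightarrow> (nat \<Rightarrow> real) \<Rightarrow> real" where
  "ip n x y = (\<Sum>i<n. x i * y i)"

definition mat_prod ::
    "nat \<Rightarrow> (nat \<Rightarrow> nat \<Rightarrow> real) \<Rightarrow> (nat \<Rightarrow> nat \<Rightarrow> real) \<Rightarrow> nat \<Rightarrow> nat \<Rightarrow> real" where
  "mat_prod n A B = (\<lambda>i j. \<Sum>l<n. A i l * B l j)"

text \<open>For \<open>d = 0\<close> the division by zero makes this the identity matrix.\<close>

definition reflection :: "nat \<Rightarrow> (nat \<Rightarrow> real) \<Rightarrow> nat \<Rightarrow> nat \<Rightarrow> real" where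
  "reflection n d = (\<lambda>i j. (if i = j then 1 else 0) - 2 * d i * d j / ip n d d)"

lemma ip_commute: "ip n x y = ip n y x"
  by (simp add: ip_def mult.commute)

lemma ip_diff_left: "ip n (\<lambda>i. x i - y i) z = ip n x z - ip n y z"
  by (simp add: ip_def algebra_simps sum_subtractf)

lemma ip_diff_right: "ip n z (\<lambda>i. x i - y i) = ip n z x - ip n z y"
  by (simp add: ip_def algebra_simps sum_subtractf)

lemma ip_self_eq_0_iff: "ip n x x = 0 \<longleftrightarrow> (\<forall>i<n. x i = 0)"
  by (auto simp: ip_def sum_nonneg_eq_0_iff)

lemma in_Rn_mat_app: "in_Rn n (mat_app n M x)"
  by (simp add: in_Rn_def mat_app_def)

lemma mat_app_mat_prod: "mat_app n (mat_prod n A B) x = mat_app n A (mat_app n B x)"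
proof -
  have "(\<Sum>j<n. (\<Sum>l<n. A i l * B l j) * x j) = (\<Sum>l<n. A i l * (\<Sum>j<n. B l j * x j))" for i
    unfolding sum_distrib_left sum_distrib_right
    by (subst sum.swap) (simp add: mult.assoc)
  then show ?thesis
    by (auto simp: mat_app_def mat_prod_def fun_eq_iff intro!: sum.cong)
qed

lemma mat_prod_assoc: "mat_prod n (mat_prod n A B) C = mat_prod n A (mat_prod n B C)"
proof -
  have "(\<Sum>l<n. (\<Sum>k<n. A i k * B k l) * C l j) = (\<Sum>k<n. A i k * (\<Sum>l<n. B k l * C l j))" for i j
    unfolding sum_distrib_left sum_distrib_right
    by (subst sum.swap) (simp add: mult.assoc)
  then show ?thesis
    by (simp add: mat_prod_def fun_eq_iff)
qed

lemma orthogonal_n_iff_ip: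
  "orthogonal_n n M \<longleftrightarrow> (\<forall>i<n. \<forall>j<n. ip n (\<lambda>l. M l i) (\<lambda>l. M l j) = (if i = j then 1 else 0))"
  by (simp add: orthogonal_n_def ip_def)

lemma ip_mat_app_orthogonal:
  assumes "orthogonal_n n M"
  shows "ip n (mat_app n M x) (mat_app n M y) = ip n x y"
proof -
  have "ip n (mat_app n M x) (mat_app n M y) =
      (\<Sum>l<n. \<Sum>i<n. \<Sum>j<n. x i * (y j * (M l i * M l j)))"
    by (auto simp: ip_def mat_app_def sum_product algebra_simps intro!: sum.cong)
  also have "\<dots> = (\<Sum>i<n. \<Sum>j<n. \<Sum>l<n. x i * (y j * (M l i * M l j)))"
    by (subst sum.swap, rule sum.cong[OF refl], rule sum.swap)
  also have "\<dots> = (\<Sum>i<n. \<Sum>j<n. x i * (y j * (if i = j then 1 else 0)))"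
    using assms by (simp add: orthogonal_n_def flip: sum_distrib_left)
  also have "\<dots> = ip n x y"
    by (simp add: ip_def if_distrib [of "(*) _"] sum.delta cong: if_cong)
  finally show ?thesis .
qed

lemma orthogonal_n_mat_prod:
  assumes "orthogonal_n n A" and "orthogonal_n n B"
  shows "orthogonal_n n (mat_prod n A B)"
  unfolding orthogonal_n_iff_ip
proof (intro allI impI)
  fix i j assume "i < n" "j < n"
  have "ip n (\<lambda>l. mat_prod n A B l i) (\<lambda>l. mat_prod n A B l j)
      = ip n (mat_app n A (\<lambda>l. B l i)) (mat_app n A (\<lambda>l. B l j))"
    by (simp add: ip_def mat_app_def mat_prod_def)
  also have "\<dots> = ip n (\<lambda>l. B l i) (\<lambda>l. B l j)"
    by (rule ip_mat_app_orthogonal) fact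
  finally show "ip n (\<lambda>l. mat_prod n A B l i) (\<lambda>l. mat_prod n A B l j) = (if i = j then 1 else 0)"
    using assms(2) \<open>i < n\<close> \<open>j < n\<close> by (simp add: orthogonal_n_iff_ip)
qed

lemma mat_app_reflection:
  assumes "in_Rn n d" and "in_Rn n x"
  shows "mat_app n (reflection n d) x = (\<lambda>i. x i - 2 * ip n d x / ip n d d * d i)"
proof
  fix i
  show "mat_app n (reflection n d) x i = x i - 2 * ip n d x / ip n d d * d i"
  proof (cases "i < n")
    case True
    have "(\<Sum>j<n. reflection n d i j * x j)
        = (\<Sum>j<n. (if i = j then x j else 0) - (2 / ip n d d * d i) * (d j * x j))"
      by (intro sum.cong) (auto simp: reflection_def algebra_simps)
    also have "\<dots> = x i - (2 / ip n d d * d i) * ip n d x"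
      using True by (simp add: sum_subtractf ip_def sum_distrib_left)
    finally show ?thesis
      using True by (simp add: mat_app_def)
  next
    case False
    then show ?thesis
      using assms by (simp add: mat_app_def in_Rn_def)
  qed
qed

text \<open>For vectors of equal length, \<open>d = x - y\<close> satisfies
  \<open>ip n d d = 2 * ip n d x\<close>, so the reflection formula subtracts exactly
  \<open>d\<close> from \<open>x\<close>. The case \<open>x = y\<close> is covered because the
  matrix is then the identity.\<close>

lemma mat_app_reflection_swap:
  assumes "in_Rn n x" and "in_Rn n y" and "ip n x x = ip n y y"
  shows "mat_app n (reflection n (\<lambda>i. x i - y i)) x = y"
proof -
  let ?d = "\<lambda>i. x i - y i"
  have d: "in_Rn n ?d"
    using assms by (simp add: in_Rn_def)
  have dd: "ip n ?d ?d = 2 * ip n ?d x"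
    using assms(3) by (simp add: ip_diff_left ip_diff_right ip_commute[of n y x])
  have "x i - 2 * ip n ?d x / ip n ?d ?d * ?d i = y i" for i
  proof (cases "ip n ?d ?d = 0")
    case True
    then have "?d i = 0"
      using d by (cases "i < n") (auto simp: ip_self_eq_0_iff in_Rn_def)
    then show ?thesis by simp
  next
    case False
    then show ?thesis by (simp add: dd)
  qed
  then show ?thesis
    using mat_app_reflection[OF d assms(1)] by auto
qed

lemma mat_app_reflection_fix:
  assumes "in_Rn n d" and "in_Rn n x" and "ip n d x = 0"
  shows "mat_app n (reflection n d) x = x"
  using assms by (simp add: mat_app_reflection)

text \<open>Squaring \<open>I - 2 d d^T / N\<close> with \<open>N = ip n d d\<close> gives
  \<open>I - 4 d d^T / N + 4 N d d^T / (N * N)\<close>. The last two terms cancel, or both vanish by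
  the convention on division when \<open>N = 0\<close>.\<close>

lemma mat_prod_reflection_reflection:
  assumes "i < n" and "j < n"
  shows "mat_prod n (reflection n d) (reflection n d) i j = (if i = j then 1 else 0)"
proof -
  let ?N = "ip n d d"
  have "mat_prod n (reflection n d) (reflection n d) i j
      = (\<Sum>l<n. (if i = l then (if l = j then 1 else 0) else 0)
            - (if i = l then 2 * d l * d j / ?N else 0)
            - (if l = j then 2 * d i * d l / ?N else 0)
            + (4 * d i * d j / (?N * ?N)) * (d l * d l))"
    unfolding mat_prod_def by (intro sum.cong) (auto simp: reflection_def algebra_simps)
  also have "\<dots> = (if i = j then 1 else 0) - 4 * d i * d j / ?N + 4 * d i * d j / (?N * ?N) * ?N"
    unfolding sum.distrib sum_subtractf sum_distrib_left[symmetric] ip_def[symmetric]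
    using assms by simp
  finally show ?thesis by (cases "?N = 0") auto
qed

text \<open>A symmetric involution is its own transposed inverse.\<close>

lemma orthogonal_n_reflection: "orthogonal_n n (reflection n d)"
proof -
  have "reflection n d l i = reflection n d i l" for l i
    by (simp add: reflection_def)
  then show ?thesis
    using mat_prod_reflection_reflection[of _ n _ d] by (simp add: orthogonal_n_def mat_prod_def)
qed

lemma mat_app_reflection_reflection:
  assumes "in_Rn n x"
  shows "mat_app n (reflection n d) (mat_app n (reflection n d) x) = x"
proof
  fix i
  show "mat_app n (reflection n d) (mat_app n (reflection n d) x) i = x i"
    unfolding mat_app_mat_prod[symmetric] using assms mat_prod_reflection_reflection[of i n _ d]
    by (simp add: mat_app_def in_Rn_def if_distrib [of "\<lambda>a. a * _"] cong: if_cong)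
qed

section \<open>Conjugating an action by a reflection\<close>

lemma mat_prod_cong_mid:
  assumes "\<And>i j. i < n \<Longrightarrow> j < n \<Longrightarrow> B i j = B' i j"
  shows "mat_prod n A (mat_prod n B C) = mat_prod n A (mat_prod n B' C)"
  using assms by (auto simp: mat_prod_def fun_eq_iff intro!: sum.cong)

lemma mat_prod_reflection_cancel:
  assumes "i < n"
  shows "mat_prod n (reflection n d) (mat_prod n (reflection n d) A) i j = A i j"
  unfolding mat_prod_assoc[symmetric]
  using assms mat_prod_reflection_reflection[of i n _ d]
  by (subst mat_prod_def) (simp add: if_distrib [of "\<lambda>a. a * _"] cong: if_cong)

lemma orth_action_conj:
  assumes "orth_action p \<alpha> n \<rho>"
  shows "orth_action p \<alpha> n (\<lambda>g. mat_prod n (reflection n d) (mat_prod n (\<rho> g) (reflection n d)))"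
  unfolding orth_action_def
proof (intro conjI ballI allI impI)
  fix g assume "g \<in> ptorus p \<alpha>"
  then show "orthogonal_n n (mat_prod n (reflection n d) (mat_prod n (\<rho> g) (reflection n d)))"
    using assms by (simp add: orth_action_def orthogonal_n_mat_prod orthogonal_n_reflection)
next
  let ?R = "reflection n d"
  fix g h i j assume gh: "g \<in> ptorus p \<alpha>" "h \<in> ptorus p \<alpha>" and ij: "i < n" "j < n"
  have "mat_prod n ?R (mat_prod n (\<rho> (ptorus_add p g h)) ?R)
      = mat_prod n ?R (mat_prod n (mat_prod n (\<rho> g) (\<rho> h)) ?R)"
    using assms gh by (intro mat_prod_cong_mid) (simp add: orth_action_def mat_prod_def)
  also have "\<dots> = mat_prod n ?R (mat_prod n (\<rho> g) (mat_prod n (\<rho> h) ?R))"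
    by (simp add: mat_prod_assoc)
  \<comment> \<open>The square of \<open>?R\<close>, which is the identity on indices below
    \<open>n\<close>, is inserted between the two factors.\<close>
  also have "\<dots> = mat_prod n ?R (mat_prod n (\<rho> g)
      (mat_prod n ?R (mat_prod n ?R (mat_prod n (\<rho> h) ?R))))"
    (is "_ = mat_prod n ?R ?rhs")
  proof -
    have "mat_prod n (\<rho> g) (mat_prod n (\<rho> h) ?R) = ?rhs"
      unfolding fun_eq_iff mat_prod_def[of n "\<rho> g"]
      by (simp add: mat_prod_reflection_cancel)
    then show ?thesis by simp
  qed
  also have "\<dots> = mat_prod n (mat_prod n ?R (mat_prod n (\<rho> g) ?R)) (mat_prod n ?R (mat_prod n (\<rho> h) ?R))"
    by (simp add: mat_prod_assoc)
  finally show "mat_prod n ?R (mat_prod n (\<rho> (ptorus_add p g h)) ?R) i j =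
      (\<Sum>l<n. mat_prod n ?R (mat_prod n (\<rho> g) ?R) i l * mat_prod n ?R (mat_prod n (\<rho> h) ?R) l j)"
    by (simp add: mat_prod_def)
qed

text \<open>The ambient dimension is fixed here, so that reflections of that space can act on the
  configuration.\<close>

definition in_common_orbit :: "nat \<Rightarrow> nat \<Rightarrow> (nat \<Rightarrow> real) set \<Rightarrow> bool" where
  "in_common_orbit p n Y \<longleftrightarrow> (\<exists>\<alpha>\<ge>1. \<exists>\<rho>. orth_action p \<alpha> n \<rho> \<and>
        (\<exists>v \<in> unit_sphere_n n. Y \<subseteq> orbit_n p \<alpha> n \<rho> v))"

lemma unit_sphere_n_iff: "v \<in> unit_sphere_n n \<longleftrightarrow> in_Rn n v \<and> ip n v v = 1"
  by (simp add: unit_sphere_n_def ip_def power2_eq_square)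

text \<open>A reflection maps the orbit of \<open>v\<close> onto the orbit of the reflected
  \<open>v\<close> under the conjugated action.\<close>

lemma in_common_orbit_reflect:
  assumes "in_common_orbit p n Y"
  shows "in_common_orbit p n (mat_app n (reflection n d) ` Y)"
proof -
  let ?R = "reflection n d"
  obtain \<alpha> \<rho> v where \<alpha>: "\<alpha> \<ge> 1" and act: "orth_action p \<alpha> n \<rho>" and v: "v \<in> unit_sphere_n n"
    and Y: "Y \<subseteq> orbit_n p \<alpha> n \<rho> v"
    using assms unfolding in_common_orbit_def by blast
  define \<rho>' where "\<rho>' = (\<lambda>g. mat_prod n ?R (mat_prod n (\<rho> g) ?R))"
  have v': "mat_app n ?R v \<in> unit_sphere_n n"
    using v by (simp add: unit_sphere_n_iff in_Rn_mat_app ip_mat_app_orthogonal orthogonal_n_reflection)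
  have "mat_app n (\<rho>' g) (mat_app n ?R v) = mat_app n ?R (mat_app n (\<rho> g) v)" for g
    using v by (simp add: \<rho>'_def mat_app_mat_prod mat_app_reflection_reflection unit_sphere_n_iff)
  then have "mat_app n ?R ` Y \<subseteq> orbit_n p \<alpha> n \<rho>' (mat_app n ?R v)"
    using Y unfolding orbit_n_def by auto
  then show ?thesis
    using \<alpha> v' orth_action_conj[OF act, of d, folded \<rho>'_def] unfolding in_common_orbit_def by blast
qed

text \<open>Equal Gram matrices let three reflections carry one triple to the other, one point at a
  time. Each later reflection fixes the points already placed, because its normal vector is
  orthogonal to them.\<close>

lemma in_common_orbit_congruent:
  assumes "in_common_orbit p n {x', y', z'}"
    and R: "in_Rn n x'" "in_Rn n y'" "in_Rn n z'" "in_Rn n x" "in_Rn n y" "in_Rn n z"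
    and sq: "ip n x' x' = ip n x x" "ip n y' y' = ip n y y" "ip n z' z' = ip n z z"
    and xy: "ip n x' y' = ip n x y" and yz: "ip n y' z' = ip n y z" and xz: "ip n x' z' = ip n x z"
  shows "in_common_orbit p n {x, y, z}"
proof -
  define A where "A = mat_app n (reflection n (\<lambda>i. x' i - x i))"
  define B where "B = mat_app n (reflection n (\<lambda>i. A y' i - y i))"
  define C where "C = mat_app n (reflection n (\<lambda>i. B (A z') i - z i))"
  have ipA: "ip n (A u) (A w) = ip n u w" and ipB: "ip n (B u) (B w) = ip n u w" for u w
    by (simp_all add: A_def B_def ip_mat_app_orthogonal orthogonal_n_reflection)
  have RA: "in_Rn n (A u)" and RB: "in_Rn n (B u)" for u
    by (simp_all add: A_def B_def in_Rn_mat_app)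
  have R_diff: "in_Rn n (\<lambda>i. u i - w i)" if "in_Rn n u" "in_Rn n w" for u w
    using that by (simp add: in_Rn_def)
  have Ax: "A x' = x"
    using R sq by (simp add: A_def mat_app_reflection_swap)
  have By: "B (A y') = y"
    using R sq by (simp add: B_def mat_app_reflection_swap RA ipA)
  have Cz: "C (B (A z')) = z"
    using R sq by (simp add: C_def mat_app_reflection_swap RB ipA ipB)
  \<comment> \<open>Both \<open>A y'\<close> and \<open>y\<close> have the same inner product with
    \<open>x\<close>, so the normal of \<open>B\<close> is orthogonal to \<open>x\<close>. The same
    argument applies to \<open>C\<close> with \<open>x\<close> and \<open>y\<close>.\<close>
  have "ip n (A y') x = ip n y x"
    using ipA[of y' x'] xy by (simp add: Ax ip_commute)
  then have Bx: "B x = x"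
    unfolding B_def using R by (intro mat_app_reflection_fix R_diff RA) (simp_all add: ip_diff_left)
  have "ip n (B (A z')) x = ip n z x"
    using ipA[of z' x'] ipB[of "A z'" "A x'"] xz by (simp add: Ax Bx ip_commute)
  then have Cx: "C x = x"
    unfolding C_def using R by (intro mat_app_reflection_fix R_diff RB) (simp_all add: ip_diff_left)
  have "ip n (B (A z')) y = ip n z y"
    using ipA[of z' y'] ipB[of "A z'" "A y'"] yz by (simp add: By ip_commute)
  then have Cy: "C y = y"
    unfolding C_def using R by (intro mat_app_reflection_fix R_diff RB) (simp_all add: ip_diff_left)
  have "in_common_orbit p n (C ` B ` A ` {x', y', z'})"
    unfolding A_def B_def C_def by (intro in_common_orbit_reflect assms(1))
  then show ?thesis
    by (simp add: Ax By Cz Bx Cx Cy)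
qed

section \<open>Orbits of sums of plane rotations\<close>

lemma sum_lessThan_double:
  "(\<Sum>l<2 * m. f l) = (\<Sum>k<m. f (2 * k) + f (Suc (2 * k)))"
  for f :: "nat \<Rightarrow> real"
  by (induction m) auto

lemma less_double_cases:
  fixes i :: nat
  assumes "i < 2 * m"
  obtains k where "k < m" "i = 2 * k" | k where "k < m" "i = Suc (2 * k)"
proof (cases "even i")
  case True
  then show ?thesis
    using assms that(1)[of "i div 2"] by auto
next
  case False
  then show ?thesis
    using assms that(2)[of "i div 2"] by auto
qed

text \<open>The block diagonal matrix whose block number \<open>k\<close>, on the coordinates
  \<open>2 * k\<close> and \<open>Suc (2 * k)\<close>, is the rotation by
  \<open>\<tau> k\<close>.\<close>

definition block_rot :: "(nat \<Rightarrow> real) \<Rightarrow> nat \<Rightarrow> nat \<Rightarrow> real" where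
  "block_rot \<tau> i j =
    (if i div 2 = j div 2
     then if i = j then cos (\<tau> (i div 2)) else if even i then - sin (\<tau> (i div 2)) else sin (\<tau> (i div 2))
     else 0)"

lemma block_rot_simps [simp]:
  "block_rot \<tau> (2 * k) (2 * l) = (if k = l then cos (\<tau> k) else 0)"
  "block_rot \<tau> (2 * k) (Suc (2 * l)) = (if k = l then - sin (\<tau> k) else 0)"
  "block_rot \<tau> (Suc (2 * k)) (2 * l) = (if k = l then sin (\<tau> k) else 0)"
  "block_rot \<tau> (Suc (2 * k)) (Suc (2 * l)) = (if k = l then cos (\<tau> k) else 0)"
proof -
  have "2 * k \<noteq> Suc (2 * l)" "Suc (2 * k) \<noteq> 2 * l"
    by presburger+
  then show
    "block_rot \<tau> (2 * k) (2 * l) = (if k = l then cos (\<tau> k) else 0)"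
    "block_rot \<tau> (2 * k) (Suc (2 * l)) = (if k = l then - sin (\<tau> k) else 0)"
    "block_rot \<tau> (Suc (2 * k)) (2 * l) = (if k = l then sin (\<tau> k) else 0)"
    "block_rot \<tau> (Suc (2 * k)) (Suc (2 * l)) = (if k = l then cos (\<tau> k) else 0)"
    by (simp_all add: block_rot_def)
qed

lemma orthogonal_n_block_rot: "orthogonal_n (2 * m) (block_rot \<tau>)"
  unfolding orthogonal_n_def
proof (intro allI impI)
  fix i j :: nat
  assume i: "i < 2 * m" and j: "j < 2 * m"
  have ne: "2 * k \<noteq> Suc (2 * l)" "Suc (2 * k) \<noteq> 2 * l" for k l :: nat
    by presburger+
  have sum_eq: "(\<Sum>k<m. if k = a then if k = b then f k else 0 else 0) = (if a = b then f a else 0)"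
    if "a < m" for a b and f :: "nat \<Rightarrow> real"
    using that by simp
  \<comment> \<open>These rewrites turn products of block entries into nested conditionals, which
    \<open>sum_eq\<close> then collapses to a single block.\<close>
  have *: "(if P then u else 0) * (if Q then w else 0) = (if P then if Q then u * w else 0 else 0)"
     "(if P then if Q then u else 0 else 0) + (if P then if Q then w else 0 else 0)
       = (if P then if Q then u + w else 0 else 0)" for P Q and u w :: real
    by auto
  show "(\<Sum>l<2 * m. block_rot \<tau> l i * block_rot \<tau> l j) = (if i = j then 1 else 0)"
    using i j
    by (elim less_double_cases)
      (simp_all add: sum_lessThan_double * sum_eq ne flip: power2_eq_square)
qed

lemma block_rot_add:
  assumes "i < 2 * m" and "j < 2 * m"
  shows "block_rot (\<lambda>k. \<sigma> k + \<tau> k) i j = (\<Sum>l<2 * m. block_rot \<sigma> i l * block_rot \<tau> l j)"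
proof -
  have sum_eq: "(\<Sum>k<m. if a = k then if k = b then f k else 0 else 0) = (if a = b then f a else 0)"
    if "a < m" for a b and f :: "nat \<Rightarrow> real"
    using that by simp
  have *: "(if P then u else 0) * (if Q then w else 0) = (if P then if Q then u * w else 0 else 0)"
     "(if P then if Q then u else 0 else 0) + (if P then if Q then w else 0 else 0)
       = (if P then if Q then u + w else 0 else 0)" for P Q and u w :: real
    by auto
  show ?thesis
    using assms
    by (elim less_double_cases)
      (simp_all add: sum_lessThan_double * sum_eq cos_add sin_add)
qed

lemma block_rot_cong_2pi:
  assumes "\<And>k. \<exists>q::int. \<sigma> k = \<tau> k + 2 * pi * of_int q"
  shows "block_rot \<sigma> = block_rot \<tau>"
proof -
  have "sin (\<sigma> k) = sin (\<tau> k) \<and> cos (\<sigma> k) = cos (\<tau> k)" for k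
    using assms[of k] by (simp add: sin_cos_eq_iff)
  then show ?thesis
    by (simp add: block_rot_def fun_eq_iff)
qed

text \<open>The character of a \<open>p\<close>-torus with weights \<open>s\<close>,
  \<open>t\<close> on the first two components, written as an angle. Rank two suffices because three
  points of an orbit have two independent differences.\<close>

definition angle :: "nat \<Rightarrow> int \<Rightarrow> int \<Rightarrow> (nat \<Rightarrow> nat) \<Rightarrow> real" where
  "angle p s t g = 2 * pi * of_int (s * int (g 0) + t * int (g 1)) / real p"

text \<open>Reducing a component modulo \<open>p\<close> changes the angle by whole turns only, so
  the rotations, unlike the angles, are additive.\<close>

lemma angle_ptorus_add:
  assumes "p > 0"
  shows "\<exists>q::int. angle p s t (ptorus_add p g h) = angle p s t g + angle p s t h + 2 * pi * of_int q"
proof -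
  define q where "q = (\<lambda>i. int ((g i + h i) div p))"
  have *: "int ((g i + h i) mod p) = int (g i) + int (h i) - int p * q i" for i
    unfolding q_def by (metis minus_div_mult_eq_mod[of "int (g i) + int (h i)" "int p"] mult.commute of_nat_add of_nat_mod zdiv_int)
  have "angle p s t (ptorus_add p g h)
      = angle p s t g + angle p s t h + 2 * pi * of_int (- (s * q 0 + t * q 1))"
    using assms unfolding angle_def ptorus_add_def * by (simp add: field_simps)
  then show ?thesis ..
qed

lemma orth_action_block_rot:
  assumes "p > 0"
  shows "orth_action p \<alpha> (2 * m) (\<lambda>g. block_rot (\<lambda>k. angle p (s k) (t k) g))"
  unfolding orth_action_def
proof (intro conjI ballI allI impI orthogonal_n_block_rot)
  fix g h i j assume "i < 2 * m" "j < 2 * m"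
  moreover have "block_rot (\<lambda>k. angle p (s k) (t k) (ptorus_add p g h))
      = block_rot (\<lambda>k. angle p (s k) (t k) g + angle p (s k) (t k) h)"
    by (intro block_rot_cong_2pi angle_ptorus_add assms)
  ultimately show "block_rot (\<lambda>k. angle p (s k) (t k) (ptorus_add p g h)) i j =
      (\<Sum>l<2 * m. block_rot (\<lambda>k. angle p (s k) (t k) g) i l * block_rot (\<lambda>k. angle p (s k) (t k) h) l j)"
    by (simp only: block_rot_add)
qed

text \<open>In each coordinate plane this vector lies on the first axis and has squared length
  \<open>u k\<close>, so convex weights \<open>u\<close> give a unit vector.\<close>

definition even_vec :: "nat \<Rightarrow> (nat \<Rightarrow> real) \<Rightarrow> nat \<Rightarrow> real" where
  "even_vec m u i = (if i < 2 * m \<and> even i then sqrt (u (i div 2)) else 0)"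

text \<open>Plane \<open>k\<close> contributes the inner product of two vectors of squared length
  \<open>u k\<close> enclosing the angle \<open>\<sigma> k - \<tau> k\<close>. Convex combinations
  of cosines thus become inner products of orbit points.\<close>

lemma ip_block_rot_even_vec:
  assumes "\<And>k. u k \<ge> 0"
  shows "ip (2 * m) (mat_app (2 * m) (block_rot \<sigma>) (even_vec m u))
      (mat_app (2 * m) (block_rot \<tau>) (even_vec m u)) = (\<Sum>k<m. u k * cos (\<sigma> k - \<tau> k))"
proof -
  have e: "even_vec m u (2 * l) = sqrt (u l)" "even_vec m u (Suc (2 * l)) = 0" if "l < m" for l
    using that by (simp_all add: even_vec_def)
  have 1: "mat_app (2 * m) (block_rot \<sigma>) (even_vec m u) (2 * k) = sqrt (u k) * cos (\<sigma> k)"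
    and 2: "mat_app (2 * m) (block_rot \<sigma>) (even_vec m u) (Suc (2 * k)) = sqrt (u k) * sin (\<sigma> k)"
    if "k < m" for k \<sigma>
    using that by (simp_all add: mat_app_def sum_lessThan_double e
        if_distrib [of "\<lambda>a. a * _"] cong: if_cong sum.cong_simp)
  have "sqrt (u k) * cos (\<sigma> k) * (sqrt (u k) * cos (\<tau> k)) + sqrt (u k) * sin (\<sigma> k) * (sqrt (u k) * sin (\<tau> k))
      = sqrt (u k) * sqrt (u k) * cos (\<sigma> k - \<tau> k)" for k
    by (simp add: cos_diff algebra_simps del: real_sqrt_mult_self)
  then show ?thesis
    unfolding ip_def using assms by (simp add: sum_lessThan_double 1 2)
qed

lemma even_vec_in_unit_sphere_n:
  assumes "\<And>k. u k \<ge> 0" and "(\<Sum>k<m. u k) = 1"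
  shows "even_vec m u \<in> unit_sphere_n (2 * m)"
  using assms
  by (auto simp: unit_sphere_n_iff in_Rn_def ip_def sum_lessThan_double even_vec_def)

text \<open>The possible \<open>(x \<bullet> y, y \<bullet> z, x \<bullet> z)\<close> for three
  points in one orbit of the rotation by \<open>2 \<pi> / p\<close> on the unit circle;
  \<open>s\<close> and \<open>t\<close> are the steps between consecutive points.\<close>

definition circle_grams :: "nat \<Rightarrow> (real \<times> real \<times> real) set" where
  "circle_grams p = {(cos (2 * pi * of_int s / real p), cos (2 * pi * of_int t / real p),
      cos (2 * pi * of_int (s + t) / real p)) | s t :: int. True}"

text \<open>Each term of the convex combination is realised in its own plane: its coefficient is the
  squared length there and its pair \<open>s\<close>, \<open>t\<close> the character. Three orbit
  points then have the prescribed Gram matrix, and a congruence moves them to \<open>x\<close>,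
  \<open>y\<close>, \<open>z\<close>.\<close>

lemma spherical_sub_p_toral_if_gram:
  assumes p: "p \<ge> 2"
    and unit: "x \<in> unit_sphere_n 3" "y \<in> unit_sphere_n 3" "z \<in> unit_sphere_n 3"
    and gram: "(ip 3 x y, ip 3 y z, ip 3 x z) \<in> convex hull (circle_grams p)"
  shows "spherical_sub_p_toral p 3 {x, y, z}"
proof -
  obtain k u q where u: "\<forall>i\<in>{1::nat..k}. 0 \<le> u i \<and> q i \<in> circle_grams p" and u1: "sum u {1..k} = 1"
    and q: "(\<Sum>i\<in>{1..k}. u i *\<^sub>R q i) = (ip 3 x y, ip 3 y z, ip 3 x z)"
    using gram unfolding convex_hull_indexed by auto
  have "\<forall>i\<in>{1..k}. \<exists>s t. q i = (cos (2 * pi * of_int s / real p), cos (2 * pi * of_int t / real p),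
      cos (2 * pi * of_int (s + t) / real p))"
    using u unfolding circle_grams_def by auto
  then obtain s t where st: "\<And>i. i \<in> {1..k} \<Longrightarrow> q i = (cos (2 * pi * of_int (s i) / real p),
      cos (2 * pi * of_int (t i) / real p), cos (2 * pi * of_int (s i + t i) / real p))"
    by metis
  \<comment> \<open>Planes \<open>0\<close> and \<open>k + 1\<close> are spare and get weight zero.
    All indices of \<open>{1..k}\<close> then lie below \<open>m\<close>, and \<open>2 * m\<close>
    is at least 3.\<close>
  define m where "m = k + 2"
  define w where "w = (\<lambda>i. if i \<in> {1..k} then u i else 0)"
  have w0: "w i \<ge> 0" for i
    using u by (simp add: w_def)
  have sum_w: "(\<Sum>i<m. w i * f i) = (\<Sum>i\<in>{1..k}. u i * f i)" for f
  proof -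
    have "(\<Sum>i<m. w i * f i) = (\<Sum>i\<in>{1..k}. w i * f i)"
      by (rule sum.mono_neutral_right) (auto simp: m_def w_def)
    then show ?thesis by (simp add: w_def)
  qed
  have w1: "(\<Sum>i<m. w i) = 1"
    using sum_w[of "\<lambda>_. 1"] u1 by simp
  define \<rho> where "\<rho> = (\<lambda>g. block_rot (\<lambda>k. angle p (s k) (t k) g))"
  define v where "v = even_vec m w"
  define P where "P = (\<lambda>g. mat_app (2 * m) (\<rho> g) v)"
  \<comment> \<open>The group elements are \<open>(1, 0)\<close>, \<open>(0, 0)\<close> and
    \<open>(0, -1)\<close>, with \<open>-1\<close> written as \<open>p - 1\<close>. Their successive
    differences \<open>(1, 0)\<close> and \<open>(0, 1)\<close> produce the steps \<open>s\<close>
    and \<open>t\<close>, and hence \<open>s + t\<close> from first to last.\<close>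
  define gx where "gx = (\<lambda>i::nat. if i = 0 then 1 else 0 :: nat)"
  define gy where "gy = (\<lambda>i::nat. 0 :: nat)"
  define gz where "gz = (\<lambda>i::nat. if i = 1 then p - 1 else 0)"
  have G: "gx \<in> ptorus p 2" "gy \<in> ptorus p 2" "gz \<in> ptorus p 2"
    using p by (auto simp: ptorus_def gx_def gy_def gz_def)
  have act: "orth_action p 2 (2 * m) \<rho>"
    unfolding \<rho>_def using p by (intro orth_action_block_rot) simp
  have v: "v \<in> unit_sphere_n (2 * m)"
    unfolding v_def by (intro even_vec_in_unit_sphere_n w0 w1)
  have ipP: "ip (2 * m) (P g) (P h) = (\<Sum>i\<in>{1..k}. u i * cos (angle p (s i) (t i) g - angle p (s i) (t i) h))"
    for g h
    unfolding P_def \<rho>_def v_def by (simp add: ip_block_rot_even_vec w0 sum_w)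
  have ip3: "ip (2 * m) a b = ip 3 a b" if "a \<in> unit_sphere_n 3" for a b
    unfolding ip_def using that
    by (intro sum.mono_neutral_right) (auto simp: m_def unit_sphere_n_iff in_Rn_def)
  have R: "in_Rn (2 * m) a" if "a \<in> unit_sphere_n 3" for a
    using that by (auto simp: m_def unit_sphere_n_iff in_Rn_def)
  have sq: "ip (2 * m) (P g) (P g) = 1" for g
    using u1 by (simp add: ipP)
  have cos_gz: "cos (c - angle p a b gz) = cos (c + 2 * pi * of_int b / real p)" for a b c
  proof -
    have "c - angle p a b gz = (c + 2 * pi * of_int b / real p) + 2 * pi * of_int (- b)"
      using p by (simp add: angle_def gz_def of_nat_diff field_simps)
    then show ?thesis
      using sin_cos_eq_iff by blast
  qed
  have in_orbit: "in_common_orbit p (2 * m) {P gx, P gy, P gz}"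
    unfolding in_common_orbit_def using act v G
    by (intro exI[of _ 2] exI[of _ \<rho>] conjI bexI[of _ v]) (auto simp: orbit_n_def P_def)
  have "(\<Sum>i\<in>{1..k}. u i *\<^sub>R q i) = (\<Sum>i\<in>{1..k}. (u i * cos (2 * pi * of_int (s i) / real p),
      u i * cos (2 * pi * of_int (t i) / real p), u i * cos (2 * pi * of_int (s i + t i) / real p)))"
    by (intro sum.cong) (simp_all add: st)
  then have q': "(\<Sum>i\<in>{1..k}. u i * cos (2 * pi * of_int (s i) / real p)) = ip 3 x y"
    "(\<Sum>i\<in>{1..k}. u i * cos (2 * pi * of_int (t i) / real p)) = ip 3 y z"
    "(\<Sum>i\<in>{1..k}. u i * cos (2 * pi * of_int (s i + t i) / real p)) = ip 3 x z"
    using q by (simp_all add: sum_prod)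
  have "in_common_orbit p (2 * m) {x, y, z}"
  proof (rule in_common_orbit_congruent[OF in_orbit])
    show "ip (2 * m) (P gx) (P gy) = ip (2 * m) x y"
      using q'(1) unit by (simp add: ipP ip3) (simp add: angle_def gx_def gy_def)
    show "ip (2 * m) (P gy) (P gz) = ip (2 * m) y z"
      using q'(2) unit by (simp add: ipP ip3 cos_gz) (simp add: angle_def gy_def)
    show "ip (2 * m) (P gx) (P gz) = ip (2 * m) x z"
      using q'(3) unit
      by (simp add: ipP ip3 cos_gz) (simp add: angle_def gx_def add_divide_distrib distrib_left)
    show "in_Rn (2 * m) (P gx)" "in_Rn (2 * m) (P gy)" "in_Rn (2 * m) (P gz)"
      by (simp_all add: P_def in_Rn_mat_app)
  qed (use unit in \<open>auto simp: sq ip3 R unit_sphere_n_iff[of _ 3]\<close>)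
  then show ?thesis
    unfolding spherical_sub_p_toral_def in_common_orbit_def
    by (intro exI[of _ "2 * m"]) (simp add: m_def)
qed

section \<open>Gram triples interior to the elliptope\<close>

text \<open>The third condition says that the symmetric matrix with unit diagonal and off-diagonal entries
  \<open>a, b, c\<close> has positive determinant.\<close>

definition elliptope_interior :: "(real \<times> real \<times> real) set" where
  "elliptope_interior = {(a, b, c). a\<^sup>2 < 1 \<and> b\<^sup>2 < 1 \<and> (c - a * b)\<^sup>2 < (1 - a\<^sup>2) * (1 - b\<^sup>2)}"

lemma open_elliptope_interior: "open elliptope_interior"
proof -
  have "elliptope_interior = {q. (fst q)\<^sup>2 < 1} \<inter> {q. (fst (snd q))\<^sup>2 < 1} \<inter>
      {q. (snd (snd q) - fst q * fst (snd q))\<^sup>2 < (1 - (fst q)\<^sup>2) * (1 - (fst (snd q))\<^sup>2)}"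
    by (auto simp: elliptope_interior_def)
  also have "open \<dots>"
    by (intro open_Int open_Collect_less continuous_intros)
  finally show ?thesis .
qed

definition real_circle_grams :: "(real \<times> real \<times> real) set" where
  "real_circle_grams = {(cos \<theta>, cos \<phi>, cos (\<theta> + \<phi>)) | \<theta> \<phi>. True}"

text \<open>Write \<open>a = cos \<theta>\<close> and \<open>b = cos \<phi>\<close>. The determinant
  condition says that \<open>c\<close> lies strictly between \<open>cos (\<theta> + \<phi>)\<close>
  and \<open>cos (\<theta> - \<phi>)\<close>, so the triple is on a segment joining two circle
  triples.\<close>

lemma elliptope_interior_subset_convex_hull:
  "elliptope_interior \<subseteq> convex hull real_circle_grams"
proof
  fix q assume "q \<in> elliptope_interior"
  then obtain a b c where q: "q = (a, b, c)" and a: "a\<^sup>2 < 1" and b: "b\<^sup>2 < 1"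
    and c: "(c - a * b)\<^sup>2 < (1 - a\<^sup>2) * (1 - b\<^sup>2)"
    by (auto simp: elliptope_interior_def)
  have ab: "\<bar>a\<bar> \<le> 1" "\<bar>b\<bar> \<le> 1"
    using a b by (simp_all add: abs_square_less_1 order.strict_implies_order)
  define \<theta> where "\<theta> = arccos a"
  define \<phi> where "\<phi> = arccos b"
  have cos: "cos \<theta> = a" "cos \<phi> = b"
    using ab by (simp_all add: \<theta>_def \<phi>_def cos_arccos_abs)
  define r where "r = sin \<theta> * sin \<phi>"
  have "r\<^sup>2 = (1 - a\<^sup>2) * (1 - b\<^sup>2)"
    by (simp add: r_def power_mult_distrib sin_squared_eq cos)
  then have "\<bar>c - a * b\<bar> < \<bar>r\<bar>"
    using c abs_le_square_iff[of r "c - a * b"] by linarith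
  moreover have "r \<ge> 0"
    unfolding r_def \<theta>_def \<phi>_def using ab
    by (intro mult_nonneg_nonneg sin_ge_zero arccos_lbound arccos_ubound) auto
  ultimately have "c \<in> closed_segment (a * b - r) (a * b + r)"
    by (auto simp: closed_segment_eq_real_ivl)
  then obtain u where u: "0 \<le> u" "u \<le> 1" "c = (1 - u) * (a * b - r) + u * (a * b + r)"
    by (auto simp: closed_segment_def)
  \<comment> \<open>The endpoints of the segment are \<open>cos (\<theta> + \<phi>)\<close> and \<open>cos (\<theta> - \<phi>)\<close>.\<close>
  have "(a, b, a * b - r) \<in> real_circle_grams"
    unfolding real_circle_grams_def
    by (rule CollectI, rule exI[of _ \<theta>], rule exI[of _ \<phi>]) (simp add: cos_add cos r_def)
  moreover have "(a, b, a * b + r) \<in> real_circle_grams"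
    unfolding real_circle_grams_def
    by (rule CollectI, rule exI[of _ \<theta>], rule exI[of _ "- \<phi>"]) (simp add: cos_diff cos r_def)
  ultimately have "(1 - u) *\<^sub>R (a, b, a * b - r) + u *\<^sub>R (a, b, a * b + r) \<in> convex hull real_circle_grams"
    using u(1,2) by (intro convexD[OF convex_convex_hull] hull_inc) auto
  moreover have "q = (1 - u) *\<^sub>R (a, b, a * b - r) + u *\<^sub>R (a, b, a * b + r)"
    using u(3) by (simp add: q algebra_simps)
  ultimately show "q \<in> convex hull real_circle_grams"
    by (simp only:)
qed

section \<open>Passing from real angles to multiples of \<open>2 \<pi> / p\<close>\<close>

lemma abs_cos_diff_le: "\<bar>cos x - cos y\<bar> \<le> \<bar>x - y\<bar>" for x y :: real
proof -
  have "\<bar>cos x - cos y\<bar> = 2 * \<bar>sin ((x + y) / 2)\<bar> * \<bar>sin ((y - x) / 2)\<bar>"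
    by (simp add: cos_diff_cos abs_mult)
  also have "\<dots> \<le> 2 * 1 * \<bar>(y - x) / 2\<bar>"
    by (intro mult_mono abs_sin_x_le_abs_x) auto
  finally show ?thesis by simp
qed

text \<open>Rounding both angles down costs at most \<open>\<delta> = 2 \<pi> / p\<close> in each of
  the first two cosines and \<open>2 * \<delta>\<close> in the third, hence
  \<open>4 * \<delta>\<close> in total.\<close>

lemma circle_grams_dense:
  assumes p: "p > 0" and s: "q \<in> real_circle_grams"
  shows "\<exists>q'\<in>circle_grams p. dist q q' \<le> 8 * pi / real p"
proof -
  obtain \<theta> \<phi> where q: "q = (cos \<theta>, cos \<phi>, cos (\<theta> + \<phi>))"
    using s by (auto simp: real_circle_grams_def)
  define s where "s = \<lfloor>\<theta> * real p / (2 * pi)\<rfloor>"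
  define t where "t = \<lfloor>\<phi> * real p / (2 * pi)\<rfloor>"
  define \<delta> where "\<delta> = 2 * pi / real p"
  have approx: "\<bar>x - 2 * pi * of_int \<lfloor>x * real p / (2 * pi)\<rfloor> / real p\<bar> \<le> \<delta>" for x
  proof -
    have "x - 2 * pi * of_int \<lfloor>x * real p / (2 * pi)\<rfloor> / real p
        = \<delta> * (x * real p / (2 * pi) - of_int \<lfloor>x * real p / (2 * pi)\<rfloor>)"
      using p by (simp add: \<delta>_def field_simps)
    moreover have "\<bar>x * real p / (2 * pi) - of_int \<lfloor>x * real p / (2 * pi)\<rfloor>\<bar> \<le> 1"
      by linarith
    moreover have "\<delta> > 0"
      using p by (simp add: \<delta>_def)
    ultimately show ?thesis
      by (simp add: abs_mult mult_left_le)
  qed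
  define \<theta>' where "\<theta>' = 2 * pi * of_int s / real p"
  define \<phi>' where "\<phi>' = 2 * pi * of_int t / real p"
  have d: "\<bar>\<theta> - \<theta>'\<bar> \<le> \<delta>" "\<bar>\<phi> - \<phi>'\<bar> \<le> \<delta>"
    unfolding \<theta>'_def \<phi>'_def s_def t_def by (rule approx)+
  define q' where "q' = (cos \<theta>', cos \<phi>', cos (\<theta>' + \<phi>'))"
  have "q' \<in> circle_grams p"
    unfolding circle_grams_def q'_def \<theta>'_def \<phi>'_def
    by (rule CollectI, rule exI[of _ s], rule exI[of _ t]) (simp add: add_divide_distrib distrib_left)
  moreover have "dist q q' \<le> 8 * pi / real p"
  proof -
    have "dist q q' \<le> \<bar>cos \<theta> - cos \<theta>'\<bar> + (\<bar>cos \<phi> - cos \<phi>'\<bar> + \<bar>cos (\<theta> + \<phi>) - cos (\<theta>' + \<phi>')\<bar>)"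
      unfolding q q'_def dist_norm
      by (simp, rule order_trans[OF norm_Pair_le], simp, rule norm_Pair_le[THEN order_trans], simp)
    also have "\<dots> \<le> \<delta> + (\<delta> + 2 * \<delta>)"
      using abs_cos_diff_le[of \<theta> \<theta>'] abs_cos_diff_le[of \<phi> \<phi>'] abs_cos_diff_le[of "\<theta> + \<phi>" "\<theta>' + \<phi>'"] d
      by linarith
    finally show ?thesis by (simp add: \<delta>_def)
  qed
  ultimately show ?thesis by blast
qed

text \<open>A hyperplane separating \<open>q\<close> from the discrete triples would leave some real
  circle triple on its far side at distance at least \<open>\<epsilon>\<close>. For large
  \<open>p\<close> a discrete triple is closer than that to it, a contradiction.\<close>

lemma elliptope_interior_eventually_circle_grams:
  assumes q: "q \<in> elliptope_interior"
  shows "\<exists>N. \<forall>p\<ge>N. p > 0 \<longrightarrow> q \<in> convex hull (circle_grams p)"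
proof -
  obtain \<epsilon> where \<epsilon>: "\<epsilon> > 0" "cball q \<epsilon> \<subseteq> elliptope_interior"
    using open_elliptope_interior q open_contains_cball by blast
  \<comment> \<open>From this bound on, the rounding error \<open>8 \<pi> / p\<close> is smaller
    than the radius \<open>\<epsilon>\<close>.\<close>
  define N where "N = nat \<lceil>8 * pi / \<epsilon>\<rceil> + 1"
  have "q \<in> convex hull (circle_grams p)" if N: "p \<ge> N" and p: "p > 0" for p
  proof (rule ccontr)
    assume notin: "q \<notin> convex hull (circle_grams p)"
    have small: "8 * pi / real p < \<epsilon>"
    proof -
      have "8 * pi / \<epsilon> < real p"
        using N unfolding N_def by linarith
      then show ?thesis
        using \<epsilon>(1) p by (simp add: field_simps)
    qed
    have "0 \<notin> (\<lambda>s. s - q) ` (convex hull (circle_grams p))"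
      using notin by auto
    then obtain n where "n \<noteq> 0" "\<forall>s\<in>(\<lambda>s. s - q) ` (convex hull (circle_grams p)). 0 \<le> n \<bullet> s"
      using separating_hyperplane_set_0[of "(\<lambda>s. s - q) ` (convex hull (circle_grams p))"]
        convex_translation_subtract[of "convex hull (circle_grams p)" q] convex_convex_hull by blast
    then have n: "n \<noteq> 0" "\<And>s. s \<in> circle_grams p \<Longrightarrow> n \<bullet> q \<le> n \<bullet> s"
      by (simp_all add: inner_diff_right hull_inc)
    \<comment> \<open>The point of the ball that lies furthest beyond the hyperplane through
      \<open>q\<close>.\<close>
    define q' where "q' = q - (\<epsilon> / norm n) *\<^sub>R n"
    have "q' \<in> cball q \<epsilon>"
      using n(1) \<epsilon>(1) by (simp add: q'_def dist_norm)
    then have "q' \<in> convex hull real_circle_grams"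
      using \<epsilon>(2) elliptope_interior_subset_convex_hull by blast
    moreover have "n \<bullet> q' = n \<bullet> q - \<epsilon> * norm n"
      using n(1) by (simp add: q'_def inner_diff_right power2_norm_eq_inner[symmetric] power2_eq_square)
    \<comment> \<open>If all real circle triples lay in this open half-space, so would their convex
      hull, but \<open>q'\<close> is on its boundary.\<close>
    ultimately have "\<not> real_circle_grams \<subseteq> {s. n \<bullet> s > n \<bullet> q - \<epsilon> * norm n}"
      using hull_minimal[of real_circle_grams _ convex, OF _ convex_halfspace_gt] by fastforce
    then obtain s where s: "s \<in> real_circle_grams" "n \<bullet> s \<le> n \<bullet> q - \<epsilon> * norm n"
      by force
    obtain s' where s': "s' \<in> circle_grams p" "dist s s' \<le> 8 * pi / real p"
      using circle_grams_dense[OF p s(1)] by blast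
    have "n \<bullet> s' - n \<bullet> s \<le> norm n * norm (s' - s)"
      using norm_cauchy_schwarz[of n "s' - s"] by (simp add: inner_diff_right)
    also have "\<dots> < norm n * \<epsilon>"
      using s'(2) small n(1) by (simp add: dist_norm norm_minus_commute)
    finally show False
      using n(2)[OF s'(1)] s(2) by (simp add: mult.commute)
  qed
  then show ?thesis by blast
qed

section \<open>Gram triples of unit vectors\<close>

lemma inner_unit_sq_less_1:
  fixes x y :: "'a :: real_inner"
  assumes "norm x = 1" "norm y = 1" "x \<noteq> y" "x \<noteq> - y"
  shows "(x \<bullet> y)\<^sup>2 < 1"
proof -
  have "(x \<bullet> y)\<^sup>2 \<noteq> 1"
  proof
    assume "(x \<bullet> y)\<^sup>2 = 1"
    then have "x \<bullet> y = 1 \<or> x \<bullet> y = -1"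
      by (simp add: power2_eq_1_iff)
    then have "norm (x - y) ^ 2 = 0 \<or> norm (x + y) ^ 2 = 0"
      using assms by (auto simp: power2_norm_eq_inner inner_diff inner_add inner_commute norm_eq_1)
    then show False
      using assms(3,4) by (auto simp: add_eq_0_iff2)
  qed
  moreover have "(x \<bullet> y)\<^sup>2 \<le> 1"
    using Cauchy_Schwarz_ineq[of x y] assms by (simp add: norm_eq_1)
  ultimately show ?thesis by linarith
qed

text \<open>Dividing by the coefficient sum makes the combination affine. Used contrapositively: if
  the affine span misses the origin, every linear relation has coefficient sum zero.\<close>

lemma zero_in_affine_hull_3:
  fixes x y z :: "'a :: real_vector"
  assumes "u + v + w \<noteq> 0" "u *\<^sub>R x + v *\<^sub>R y + w *\<^sub>R z = 0"
  shows "0 \<in> affine hull {x, y, z}"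
proof -
  let ?s = "u + v + w"
  have "(u / ?s) *\<^sub>R x + (v / ?s) *\<^sub>R y + (w / ?s) *\<^sub>R z = (1 / ?s) *\<^sub>R (u *\<^sub>R x + v *\<^sub>R y + w *\<^sub>R z)"
    by (simp add: scaleR_add_right)
  also have "\<dots> = 0"
    using assms(2) by simp
  finally show ?thesis
    using assms(1) unfolding affine_hull_3
    by (intro CollectI exI[of _ "u / ?s"] exI[of _ "v / ?s"] exI[of _ "w / ?s"])
      (simp flip: add_divide_distrib)
qed

text \<open>The determinant inequality is Cauchy-Schwarz for the components of \<open>x\<close> and
  \<open>z\<close> orthogonal to \<open>y\<close>. Equality would make the three points collinear,
  but a line meets a sphere in at most two points.\<close>

lemma gram_in_elliptope_interior:
  fixes x y z :: "'a :: real_inner"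
  assumes unit: "norm x = 1" "norm y = 1" "norm z = 1"
    and distinct: "x \<noteq> y" "y \<noteq> z" "x \<noteq> z"
    and aff: "0 \<notin> affine hull {x, y, z}"
  shows "(x \<bullet> y, y \<bullet> z, x \<bullet> z) \<in> elliptope_interior"
proof -
  define a where "a = x \<bullet> y"
  define b where "b = y \<bullet> z"
  define c where "c = x \<bullet> z"
  have [simp]: "x \<bullet> x = 1" "y \<bullet> y = 1" "z \<bullet> z = 1"
    using unit by (simp_all add: norm_eq_1)
  have [simp]: "x \<bullet> y = a" "y \<bullet> x = a" "y \<bullet> z = b" "z \<bullet> y = b" "x \<bullet> z = c" "z \<bullet> x = c"
    by (simp_all add: a_def b_def c_def inner_commute)
  have "x \<noteq> - y"
    using zero_in_affine_hull_3[of 1 1 0 x y z] aff by auto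
  then have a: "a\<^sup>2 < 1"
    unfolding a_def using unit distinct by (intro inner_unit_sq_less_1)
  have "y \<noteq> - z"
    using zero_in_affine_hull_3[of 0 1 1 x y z] aff by auto
  then have b: "b\<^sup>2 < 1"
    unfolding b_def using unit distinct by (intro inner_unit_sq_less_1)
  define u where "u = x - a *\<^sub>R y"
  define w where "w = z - b *\<^sub>R y"
  have uu: "u \<bullet> u = 1 - a\<^sup>2" and ww: "w \<bullet> w = 1 - b\<^sup>2" and uw: "u \<bullet> w = c - a * b"
    by (simp_all add: u_def w_def inner_diff power2_eq_square algebra_simps)
  have "(u \<bullet> w)\<^sup>2 \<noteq> (u \<bullet> u) * (w \<bullet> w)"
  proof
    assume eq: "(u \<bullet> w)\<^sup>2 = (u \<bullet> u) * (w \<bullet> w)"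
    \<comment> \<open>In the equality case \<open>u\<close> coincides with its projection
      \<open>r *\<^sub>R w\<close> onto \<open>w\<close>.\<close>
    define r where "r = (u \<bullet> w) / (w \<bullet> w)"
    have w0: "w \<bullet> w \<noteq> 0"
      using b ww by simp
    have "(u - r *\<^sub>R w) \<bullet> (u - r *\<^sub>R w) = u \<bullet> u - (u \<bullet> w)\<^sup>2 / (w \<bullet> w)"
      using w0 by (simp add: r_def inner_diff inner_commute[of w u] power2_eq_square field_simps)
    also have "\<dots> = 0"
      using eq w0 by simp
    finally have "u = r *\<^sub>R w" by simp
    then have rel: "1 *\<^sub>R x + (r * b - a) *\<^sub>R y + (- r) *\<^sub>R z = 0"
      by (simp add: u_def w_def algebra_simps)
    then have "1 + (r * b - a) + (- r) = 0"
      using zero_in_affine_hull_3 aff by blast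
    then have a_eq: "a = 1 + r * b - r" by simp
    then have x_eq: "x = (1 - r) *\<^sub>R y + r *\<^sub>R z"
      using rel unfolding a_eq by (simp add: algebra_simps)
    \<comment> \<open>Now \<open>x\<close> is on the line through \<open>y\<close> and
      \<open>z\<close>. Its unit length leaves only the parameters \<open>r = 0\<close> and
      \<open>r = 1\<close>, that is \<open>y\<close> and \<open>z\<close>.\<close>
    have "1 = x \<bullet> x" by simp
    also have "\<dots> = (1 - r)\<^sup>2 + r\<^sup>2 + 2 * (r * (1 - r)) * b"
      by (subst (1 2) x_eq) (simp add: inner_add power2_eq_square algebra_simps)
    finally have "r * (r - 1) * (1 - b) = 0"
      by (simp add: power2_eq_square algebra_simps)
    then have "r = 0 \<or> r = 1"
      using b by auto
    then show False
      using x_eq distinct by auto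
  qed
  then have "(c - a * b)\<^sup>2 < (1 - a\<^sup>2) * (1 - b\<^sup>2)"
    using Cauchy_Schwarz_ineq[of u w] by (simp add: uu ww uw)
  then show ?thesis
    using a b by (simp add: elliptope_interior_def)
qed

section \<open>Linear relations along an orbit\<close>

lemma sum_roots_of_unity:
  assumes "j < p"
  shows "(\<Sum>s<p. cis (- (2 * pi * real s * real j / real p))) = (if j = 0 then of_nat p else 0)"
proof (cases "j = 0")
  case False
  define \<zeta> where "\<zeta> = cis (- (2 * pi * real j / real p))"
  have pow: "cis (- (2 * pi * real s * real j / real p)) = \<zeta> ^ s" for s
  proof -
    have "- (2 * pi * real s * real j / real p) = real s * - (2 * pi * real j / real p)"
      by simp
    then show ?thesis
      by (simp only: \<zeta>_def Complex.DeMoivre)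
  qed
  have "\<zeta> ^ p = cis (2 * pi * of_int (- int j))"
    using assms unfolding \<zeta>_def Complex.DeMoivre by simp
  also have "\<dots> = 1"
    by (rule cis_multiple_2pi) simp
  finally have "\<zeta> ^ p = 1" .
  moreover have "\<zeta> \<noteq> 1"
  proof
    assume "\<zeta> = 1"
    then have "cos (2 * pi * real j / real p) = 1"
      by (simp add: \<zeta>_def complex_eq_iff)
    then obtain q :: int where "2 * pi * real j / real p = of_int q * 2 * pi"
      by (auto simp: cos_one_2pi_int)
    then have "real j = of_int (q * int p)"
      using assms by (simp add: field_simps)
    then have "int j = q * int p"
      by linarith
    then have "int p dvd int j" by simp
    then show False
      using assms False by (auto dest: dvd_imp_le)
  qed
  ultimately show ?thesis
    using False by (simp add: pow sum_gp_strict)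
qed simp

section \<open>The discrete Fourier transform modulo \<open>p\<close>\<close>

definition dft :: "nat \<Rightarrow> (nat \<Rightarrow> complex) \<Rightarrow> nat \<Rightarrow> complex" where
  "dft p h s = (\<Sum>j<p. h j * cis (- (2 * pi * real s * real j / real p)))"

text \<open>Fourier inversion at the origin: the sum of the transform over all frequencies is
  \<open>p\<close> times \<open>h 0\<close>.\<close>

lemma dft_nonzero:
  assumes "p > 0" and "h 0 \<noteq> 0"
  shows "\<exists>s<p. dft p h s \<noteq> 0"
proof (rule ccontr)
  assume "\<not> ?thesis"
  then have "0 = (\<Sum>s<p. dft p h s)" by simp
  also have "\<dots> = (\<Sum>j<p. h j * (\<Sum>s<p. cis (- (2 * pi * real s * real j / real p))))"
    unfolding dft_def by (subst sum.swap) (simp add: sum_distrib_left)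
  also have "\<dots> = (\<Sum>j<p. h j * (if j = 0 then of_nat p else 0))"
    by (intro sum.cong refl) (simp add: sum_roots_of_unity)
  also have "\<dots> = h 0 * of_nat p"
    using assms by (simp add: if_distrib [of "(*) _"] cong: if_cong)
  finally show False
    using assms by simp
qed

lemma dft_shift:
  assumes "p > 0" and "h p = h 0"
  shows "dft p (\<lambda>j. h (Suc j)) s = cis (2 * pi * real s / real p) * dft p h s"
proof -
  define e where "e = (\<lambda>j. cis (- (2 * pi * real s * real j / real p)))"
  have e_Suc: "e j = cis (2 * pi * real s / real p) * e (Suc j)" for j
    using assms(1) unfolding e_def cis_mult by (simp add: field_simps)
  have "e p = cis (2 * pi * of_int (- int s))"
    using assms unfolding e_def by simp
  also have "\<dots> = 1"
    by (rule cis_multiple_2pi) simp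
  finally have "e p = 1" .
  \<comment> \<open>The sum over \<open>0..p\<close> is split at both ends; by periodicity the term
    for \<open>0\<close> equals the term for \<open>p\<close>.\<close>
  have "(\<Sum>j<Suc p. h j * e j) = h 0 * e 0 + (\<Sum>j<p. h (Suc j) * e (Suc j))"
    by (rule sum.lessThan_Suc_shift)
  then have "(\<Sum>j<p. h (Suc j) * e (Suc j)) = (\<Sum>j<p. h j * e j)"
    using assms(2) \<open>e p = 1\<close> by (simp add: e_def)
  moreover have "(\<Sum>j<p. h (Suc j) * e j)
      = cis (2 * pi * real s / real p) * (\<Sum>j<p. h (Suc j) * e (Suc j))"
    unfolding sum_distrib_left by (intro sum.cong refl) (subst e_Suc, simp only: mult.left_commute)
  ultimately show ?thesis
    by (simp add: dft_def e_def)
qed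

lemma dft_add: "dft p (\<lambda>j. g j + h j) s = dft p g s + dft p h s"
  by (simp add: dft_def distrib_right sum.distrib)

lemma dft_cmult: "dft p (\<lambda>j. c * h j) s = c * dft p h s"
  by (simp add: dft_def sum_distrib_left mult.assoc)

text \<open>Transforming in both indices turns each shift into multiplication by a
  \<open>p\<close>-th root of unity. At frequencies where the double transform is nonzero, it
  cancels from the relation.\<close>

lemma periodic_relation_imp_root_relation:
  fixes f :: "nat \<Rightarrow> nat \<Rightarrow> complex"
  assumes p: "p > 0" and nz: "f 0 0 \<noteq> 0"
    and per: "\<And>k. f p k = f 0 k" "\<And>j. f j p = f j 0"
    and rel: "\<And>j k. l * f j k + m * f (Suc j) k + n * f j (Suc k) = 0"
  shows "\<exists>s<p. \<exists>t<p. l + m * cis (2 * pi * real s / real p) + n * cis (2 * pi * real t / real p) = 0"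
proof -
  \<comment> \<open>The frequency is chosen for \<open>k = 0\<close> and kept for all
    \<open>k\<close>, so that \<open>H 0\<close> is nonzero and the second transform can be treated
    the same way.\<close>
  obtain s where s: "s < p" "dft p (\<lambda>j. f j 0) s \<noteq> 0"
    using dft_nonzero[of p "\<lambda>j. f j 0"] p nz by blast
  define H where "H = (\<lambda>k. dft p (\<lambda>j. f j k) s)"
  let ?u = "cis (2 * pi * real s / real p)"
  have relH: "(l + m * ?u) * H k + n * H (Suc k) = 0" for k
  proof -
    have "0 = dft p (\<lambda>j. l * f j k + m * f (Suc j) k + n * f j (Suc k)) s"
      by (simp only: rel) (simp add: dft_def)
    also have "\<dots> = l * H k + m * (?u * H k) + n * H (Suc k)"
      using dft_shift[of p "\<lambda>j. f j k" s] p per(1)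
      by (simp add: dft_add dft_cmult H_def)
    finally show ?thesis by (simp add: algebra_simps)
  qed
  obtain t where t: "t < p" "dft p H t \<noteq> 0"
    using dft_nonzero[of p H] p s by (auto simp: H_def)
  have "H p = H 0"
    using per(2) by (simp add: H_def)
  have "0 = dft p (\<lambda>k. (l + m * ?u) * H k + n * H (Suc k)) t"
    by (simp only: relH) (simp add: dft_def)
  also have "\<dots> = (l + m * ?u + n * cis (2 * pi * real t / real p)) * dft p H t"
    using dft_shift[of p H t] p \<open>H p = H 0\<close>
    by (simp add: dft_add dft_cmult distrib_right mult.assoc)
  finally show ?thesis
    using s(1) t by auto
qed

section \<open>From a group orbit to a relation between roots of unity\<close>

lemma mat_app_ptorus_add:
  assumes "orth_action p \<alpha> n \<rho>" "g \<in> ptorus p \<alpha>" "h \<in> ptorus p \<alpha>"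
  shows "mat_app n (\<rho> (ptorus_add p g h)) v = mat_app n (\<rho> g) (mat_app n (\<rho> h) v)"
proof -
  have "mat_app n (\<rho> (ptorus_add p g h)) v = mat_app n (mat_prod n (\<rho> g) (\<rho> h)) v"
    using assms by (auto simp: mat_app_def mat_prod_def orth_action_def fun_eq_iff intro!: sum.cong)
  then show ?thesis
    by (simp add: mat_app_mat_prod)
qed

text \<open>Every translate of \<open>x\<close>, \<open>y\<close>, \<open>z\<close> by a group
  element satisfies the same linear relation. The translates by multiples of \<open>b - a\<close>
  and \<open>c - a\<close> form a doubly periodic array, in which passing from \<open>x\<close> to
  \<open>y\<close> or \<open>z\<close> is a shift of one index.\<close>

lemma orbit_relation_imp_root_relation:
  assumes p: "p > 0" and act: "orth_action p \<alpha> n \<rho>"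
    and orb: "{x, y, z} \<subseteq> orbit_n p \<alpha> n \<rho> v"
    and nz: "x i \<noteq> 0"
    and rel: "\<And>i. l * x i + m * y i + r * z i = 0"
  shows "\<exists>s<p. \<exists>t<p. complex_of_real l + complex_of_real m * cis (2 * pi * real s / real p)
      + complex_of_real r * cis (2 * pi * real t / real p) = 0"
proof -
  obtain a b c where abc: "a \<in> ptorus p \<alpha>" "b \<in> ptorus p \<alpha>" "c \<in> ptorus p \<alpha>"
    and x: "x = mat_app n (\<rho> a) v" and y: "y = mat_app n (\<rho> b) v" and z: "z = mat_app n (\<rho> c) v"
    using orb by (auto simp: orbit_n_def)
  \<comment> \<open>\<open>d j k\<close> is \<open>j (b - a) + k (c - a)\<close>, with \<open>- a\<close> written as \<open>(p - 1) a\<close>.\<close>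
  define d where "d = (\<lambda>j k i. (j * (b i + (p - 1) * a i) + k * (c i + (p - 1) * a i)) mod p)"
  have d: "d j k \<in> ptorus p \<alpha>" for j k
    using abc p by (auto simp: d_def ptorus_def)
  define F where "F = (\<lambda>j k. mat_app n (\<rho> (ptorus_add p (d j k) a)) v)"
  \<comment> \<open>The terms \<open>(p - 1) * a\<close> and \<open>a\<close> add up to a multiple
    of \<open>p\<close>, so the offset \<open>b - a\<close> applied after \<open>a\<close> gives
    \<open>b\<close>.\<close>
  have shift: "(e + (b + (p - 1) * a) + a) mod p = (e + b) mod p" for e a b :: nat
  proof -
    have "e + (b + (p - 1) * a) + a = e + b + a * p"
      using p by (cases p) auto
    then show ?thesis
      by (simp only: mod_mult_self1)
  qed
  have d_Suc: "d (Suc j) k i = (j * (b i + (p - 1) * a i) + k * (c i + (p - 1) * a i) + (b i + (p - 1) * a i)) mod p"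
    "d j (Suc k) i = (j * (b i + (p - 1) * a i) + k * (c i + (p - 1) * a i) + (c i + (p - 1) * a i)) mod p"
    for i j k
    unfolding d_def by (simp_all only: mult_Suc add_ac)
  have "ptorus_add p (d (Suc j) k) a = ptorus_add p (d j k) b" for j k
    unfolding ptorus_add_def d_Suc mod_add_left_eq shift by (simp only: d_def mod_add_left_eq)
  then have F1: "F (Suc j) k = mat_app n (\<rho> (d j k)) y" for j k
    unfolding F_def y by (simp only: mat_app_ptorus_add[OF act d abc(2)])
  have "ptorus_add p (d j (Suc k)) a = ptorus_add p (d j k) c" for j k
    unfolding ptorus_add_def d_Suc mod_add_left_eq shift by (simp only: d_def mod_add_left_eq)
  then have F2: "F j (Suc k) = mat_app n (\<rho> (d j k)) z" for j k
    unfolding F_def z by (simp only: mat_app_ptorus_add[OF act d abc(3)])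
  have F0: "F j k = mat_app n (\<rho> (d j k)) x" for j k
    unfolding F_def x by (rule mat_app_ptorus_add[OF act d abc(1)])
  have per: "F p k = F 0 k" "F j p = F j 0" for j k
    by (simp_all add: F_def d_def)
  have "ptorus_add p (d 0 0) a = a"
    using abc(1) p unfolding ptorus_add_def d_def ptorus_def fun_eq_iff by (auto simp: not_le) (metis mod_less mod_0 not_le)
  then have "F 0 0 = x"
    by (simp add: F_def x)
  have relF: "l * F j k i + m * F (Suc j) k i + r * F j (Suc k) i = 0" for j k i
  proof (cases "i < n")
    case True
    have "l * F j k i + m * F (Suc j) k i + r * F j (Suc k) i
        = (\<Sum>q<n. \<rho> (d j k) i q * (l * x q + m * y q + r * z q))"
      using True
      by (simp add: F0[of j k] F1 F2 mat_app_def sum.distrib sum_distrib_left distrib_left mult.left_commute)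
    then show ?thesis
      by (simp add: rel)
  next
    case False
    then show ?thesis
      by (simp add: F0[of j k] F1 F2 mat_app_def)
  qed
  show ?thesis
  proof (rule periodic_relation_imp_root_relation[OF p, where f = "\<lambda>j k. complex_of_real (F j k i)"])
    show "complex_of_real (F 0 0 i) \<noteq> 0"
      using nz by (simp add: \<open>F 0 0 = x\<close>)
    show "complex_of_real l * complex_of_real (F j k i) + complex_of_real m * complex_of_real (F (Suc j) k i)
        + complex_of_real r * complex_of_real (F j (Suc k) i) = 0" for j k
      using relF[of j k i] by (simp flip: of_real_mult of_real_add)
  qed (simp_all add: per)
qed

text \<open>Taking norms in \<open>r v = - (l + m u)\<close> is the law of cosines and determines
  \<open>Re u\<close>. The sign of \<open>Im u\<close> is the only freedom left, and the linear
  relation then determines \<open>v\<close>.\<close>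

lemma unit_triangle_relation_unique:
  fixes u v w t :: complex and l m r :: real
  assumes nz: "l \<noteq> 0" "m \<noteq> 0" "r \<noteq> 0"
    and unit: "norm u = 1" "norm v = 1" "norm w = 1" "norm t = 1"
    and "of_real l + of_real m * u + of_real r * v = 0"
    and "of_real l + of_real m * w + of_real r * t = 0"
  shows "u = w \<and> v = t \<or> u = cnj w \<and> v = cnj t"
proof -
  have Re_eq: "2 * l * m * Re u = r\<^sup>2 - l\<^sup>2 - m\<^sup>2"
    if "norm u = 1" "norm v = 1" "of_real l + of_real m * u + of_real r * v = 0" for u v :: complex
  proof -
    have "of_real r * v = - (of_real l + of_real m * u)"
      using that(3) by (simp add: add_eq_0_iff)
    then have "(norm (of_real r * v))\<^sup>2 = (norm (of_real l + of_real m * u))\<^sup>2"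
      by (simp only: norm_minus_cancel)
    then have "r\<^sup>2 = (l + m * Re u)\<^sup>2 + (m * Im u)\<^sup>2"
      using that(2) by (simp add: norm_mult power_mult_distrib cmod_power2)
    moreover have "(Re u)\<^sup>2 + (Im u)\<^sup>2 = 1"
      using that(1) cmod_power2[of u] by simp
    then have "m\<^sup>2 * (Re u)\<^sup>2 + m\<^sup>2 * (Im u)\<^sup>2 = m\<^sup>2"
      by (metis distrib_left mult.right_neutral)
    ultimately show ?thesis
      by (simp add: power2_eq_square algebra_simps)
  qed
  have "2 * l * m * Re u = 2 * l * m * Re w"
    using Re_eq[OF unit(1,2) assms(8)] Re_eq[OF unit(3,4) assms(9)] by simp
  then have Re: "Re u = Re w"
    using nz by simp
  then have "(Im u)\<^sup>2 = (Im w)\<^sup>2"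
    using unit cmod_power2[of u] cmod_power2[of w] by simp
  then have "u = w \<or> u = cnj w"
    using Re by (auto simp: complex_eq_iff power2_eq_iff)
  then show ?thesis
  proof
    assume "u = w"
    then have "of_real r * v = of_real r * t"
      using assms(8,9) by (metis add_left_cancel)
    then show ?thesis
      using \<open>u = w\<close> nz by simp
  next
    assume u: "u = cnj w"
    have "of_real l + of_real m * cnj w + of_real r * cnj t = 0"
      using assms(9) by (metis complex_cnj_add complex_cnj_complex_of_real complex_cnj_mult complex_cnj_zero)
    then have "of_real r * v = of_real r * cnj t"
      using assms(8) u by (metis add_left_cancel)
    then show ?thesis
      using u nz by simp
  qed
qed

section \<open>Three points on the sphere\<close>

lemma inner_real3: "x \<bullet> y = x$1 * y$1 + x$2 * y$2 + x$3 * y$3" for x y :: "real^3"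
  by (simp add: inner_vec_def sum_3)

lemma ip_emb3: "ip 3 (emb3 x) (emb3 y) = x \<bullet> y"
  by (simp add: ip_def emb3_def inner_real3 numeral_3_eq_3)

lemma emb3_in_unit_sphere_n: "norm x = 1 \<Longrightarrow> emb3 x \<in> unit_sphere_n 3"
  by (simp add: unit_sphere_n_iff ip_emb3 norm_eq_1) (simp add: in_Rn_def emb3_def)

lemma spherical_sub_p_toral_emb3:
  assumes "p \<ge> 2" and "norm x = 1" "norm y = 1" "norm z = 1"
    and "(x \<bullet> y, y \<bullet> z, x \<bullet> z) \<in> convex hull (circle_grams p)"
  shows "spherical_sub_p_toral p 3 (emb3 ` {x, y, z})"
  using spherical_sub_p_toral_if_gram[of p "emb3 x" "emb3 y" "emb3 z"] assms
  by (simp add: ip_emb3 emb3_in_unit_sphere_n)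

text \<open>A right angle at \<open>a\<close> means
  \<open>b \<bullet> c = \<alpha> + \<beta> - 1\<close>, the equation of the plane through three of
  the discrete triples for \<open>p = 2\<close>.\<close>

lemma right_angled_triangle_toral:
  fixes X :: "(real^3) set"
  assumes "X \<subseteq> sphere 0 1" and "right_angled_triangle X"
  shows "spherical_sub_p_toral 2 3 (emb3 ` X)"
proof -
  obtain a b c where "X = {a, b, c}" and orth: "(b - a) \<bullet> (c - a) = 0"
    using assms(2) unfolding right_angled_triangle_def by blast
  \<comment> \<open>The vertex with the right angle goes in the middle, so that the two legs give
    the first two Gram entries.\<close>
  then have X: "X = {b, a, c}" by blast
  have unit: "norm a = 1" "norm b = 1" "norm c = 1"
    using assms(1) X by auto
  define \<alpha> where "\<alpha> = b \<bullet> a"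
  define \<beta> where "\<beta> = a \<bullet> c"
  have bc: "b \<bullet> c = \<alpha> + \<beta> - 1"
    using orth unit by (simp add: \<alpha>_def \<beta>_def inner_diff norm_eq_1)
  have "\<bar>b \<bullet> c\<bar> \<le> 1" "\<bar>\<alpha>\<bar> \<le> 1" "\<bar>\<beta>\<bar> \<le> 1"
    unfolding \<alpha>_def \<beta>_def using unit Cauchy_Schwarz_ineq2[of b c] Cauchy_Schwarz_ineq2[of b a] Cauchy_Schwarz_ineq2[of a c]
    by simp_all
  \<comment> \<open>The barycentric coordinates of the Gram triple in the face. The first is
    nonnegative because \<open>b \<bullet> c\<close> is at least \<open>-1\<close>.\<close>
  then have w: "(\<alpha> + \<beta>) / 2 \<ge> 0" "(1 - \<beta>) / 2 \<ge> 0" "(1 - \<alpha>) / 2 \<ge> 0"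
    using bc by auto
  have mem: "(cos (pi * of_int s), cos (pi * of_int t), cos (pi * of_int (s + t))) \<in> circle_grams 2"
    for s t :: int
    unfolding circle_grams_def by (rule CollectI, rule exI[of _ s], rule exI[of _ t]) simp
  have pts: "(1, 1, 1) \<in> circle_grams 2" "(1, - 1, - 1) \<in> circle_grams 2" "(- 1, 1, - 1) \<in> circle_grams 2"
    using mem[of 0 0] mem[of 0 1] mem[of 1 0] by simp_all
  have "convex hull {(1, 1, 1), (1, - 1, - 1), (- 1, 1, - 1)} \<subseteq> convex hull (circle_grams 2)"
    using pts by (intro hull_mono) auto
  moreover have "(\<alpha>, \<beta>, \<alpha> + \<beta> - 1) \<in> convex hull {(1, 1, 1), (1, - 1, - 1), (- 1, 1, - 1)}"
    unfolding convex_hull_3 using w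
    by (intro CollectI exI[of _ "(\<alpha> + \<beta>) / 2"] exI[of _ "(1 - \<beta>) / 2"] exI[of _ "(1 - \<alpha>) / 2"])
      (simp add: field_simps)
  ultimately have "(b \<bullet> a, a \<bullet> c, b \<bullet> c) \<in> convex hull (circle_grams 2)"
    unfolding bc \<alpha>_def[symmetric] \<beta>_def[symmetric] by blast
  then show ?thesis
    unfolding X using unit by (intro spherical_sub_p_toral_emb3) auto
qed

section \<open>Points of the great circle\<close>

lemma rot3_nth [simp]:
  "rot3 p k x $ 1 = cos (2 * pi * real k / real p) * x$1 - sin (2 * pi * real k / real p) * x$2"
  "rot3 p k x $ 2 = sin (2 * pi * real k / real p) * x$1 + cos (2 * pi * real k / real p) * x$2"
  "rot3 p k x $ 3 = x$3"
  by (simp_all add: rot3_def Let_def)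

lemma inner_rot3:
  assumes "norm v = 1" and "v$3 = 0"
  shows "rot3 p j v \<bullet> rot3 p k v = cos (2 * pi * of_int (int j - int k) / real p)"
proof -
  have sq: "v$1 * v$1 + v$2 * v$2 = 1"
    using assms by (simp add: norm_eq_1 inner_real3)
  have "rot3 p j v \<bullet> rot3 p k v
      = cos (2 * pi * real j / real p - 2 * pi * real k / real p) * (v$1 * v$1 + v$2 * v$2)"
    unfolding cos_diff inner_real3 rot3_nth assms(2) by (simp add: algebra_simps)
  then show ?thesis
    by (simp add: sq diff_divide_distrib right_diff_distrib)
qed

text \<open>Here the Gram triple is itself a discrete circle triple, with steps \<open>i - j\<close>
  and \<open>j - k\<close>.\<close>

lemma rot3_orbit_toral:
  fixes x y z v :: "real^3"
  assumes "p \<ge> 2" and "norm x = 1" "norm y = 1" "norm z = 1" "norm v = 1" and "v$3 = 0"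
    and "{x, y, z} \<subseteq> range (\<lambda>k. rot3 p k v)"
  shows "spherical_sub_p_toral p 3 (emb3 ` {x, y, z})"
proof (rule spherical_sub_p_toral_emb3)
  obtain i j k where "x = rot3 p i v" "y = rot3 p j v" "z = rot3 p k v"
    using assms(7) by auto
  then have "(x \<bullet> y, y \<bullet> z, x \<bullet> z) \<in> circle_grams p"
    unfolding circle_grams_def using assms(5,6)
    by (intro CollectI exI[of _ "int i - int j"] exI[of _ "int j - int k"]) (simp add: inner_rot3)
  then show "(x \<bullet> y, y \<bullet> z, x \<bullet> z) \<in> convex hull (circle_grams p)"
    by (rule hull_inc)
qed (use assms in auto)

abbreviation planar :: "real^3 \<Rightarrow> complex" where
  "planar x \<equiv> Complex (x$1) (x$2)"

lemma planar_rot3: "planar (rot3 p k x) = cis (2 * pi * real k / real p) * planar x"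
  by (simp add: complex_eq_iff)

lemma planar_eq_iff:
  assumes "x$3 = 0" "y$3 = 0"
  shows "planar x = planar y \<longleftrightarrow> x = y"
  using assms by (simp add: vec_eq_iff forall_3)

lemma norm_planar:
  assumes "x$3 = 0"
  shows "norm (planar x) = norm x"
  using assms by (simp add: cmod_def norm_eq_sqrt_inner inner_real3 power2_eq_square)

definition cross2 :: "real^3 \<Rightarrow> real^3 \<Rightarrow> real" where
  "cross2 x y = x$1 * y$2 - x$2 * y$1"

text \<open>Cramer's rule: the coefficients of the relation between three plane vectors are the
  determinants of the pairs.\<close>

lemma cross2_relation:
  assumes "x$3 = 0" "y$3 = 0" "z$3 = 0"
  shows "cross2 y z * emb3 x i + cross2 z x * emb3 y i + cross2 x y * emb3 z i = 0"
  using assms by (simp add: cross2_def emb3_def algebra_simps)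

text \<open>By Lagrange's identity a vanishing determinant forces equality in
  Cauchy-Schwarz.\<close>

lemma cross2_eq_0_imp_antipodal:
  assumes "norm x = 1" "norm y = 1" "x$3 = 0" "y$3 = 0" "x \<noteq> y" "cross2 x y = 0"
  shows "x = - y"
proof (rule ccontr)
  assume "x \<noteq> - y"
  then have "(x \<bullet> y)\<^sup>2 < 1"
    using assms by (intro inner_unit_sq_less_1)
  moreover have "(x \<bullet> y)\<^sup>2 + (cross2 x y)\<^sup>2 = (x \<bullet> x) * (y \<bullet> y)"
    using assms(3,4) by (simp add: inner_real3 cross2_def power2_eq_square algebra_simps)
  ultimately show False
    using assms by (simp add: norm_eq_1)
qed

text \<open>Thales: the angle at \<open>x\<close> over the diameter from \<open>y\<close> to
  \<open>- y\<close> is right.\<close>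

lemma antipodal_imp_right_angled_triangle:
  assumes "norm x = 1" "norm y = 1" "x \<noteq> y" "x \<noteq> - y"
  shows "right_angled_triangle {x, y, - y}"
proof -
  have "(y - x) \<bullet> (- y - x) = 0"
    using assms by (simp add: inner_diff inner_commute norm_eq_1)
  moreover have "y \<noteq> - y"
  proof
    assume "y = - y"
    then have "y \<bullet> y = - (y \<bullet> y)"
      by (metis inner_minus_left)
    then show False
      using assms(2) by (simp add: norm_eq_1)
  qed
  ultimately show ?thesis
    unfolding right_angled_triangle_def using assms(3,4) by blast
qed

text \<open>Keeps the conjugate solution of the triangle relation among the rotations indexed by
  natural numbers.\<close>

lemma cis_2pi_complement:
  assumes "s < p"
  shows "cis (2 * pi * real (p - s) / real p) = cnj (cis (2 * pi * real s / real p))"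
proof -
  have "2 * pi * real (p - s) / real p = 2 * pi + - (2 * pi * real s / real p)"
    using assms by (simp add: of_nat_diff field_simps)
  then show ?thesis
    by (simp only: cis_cnj cis_mult[symmetric] cis_2pi mult_1_left)
qed

lemma planar_toral_cases:
  fixes x y z :: "real^3"
  assumes unit: "norm x = 1" "norm y = 1" "norm z = 1"
    and distinct: "x \<noteq> y" "y \<noteq> z" "x \<noteq> z"
    and plane: "x$3 = 0" "y$3 = 0" "z$3 = 0"
    and p: "p > 0" and toral: "spherical_sub_p_toral p 3 (emb3 ` {x, y, z})"
  shows "right_angled_triangle {x, y, z} \<or> {x, y, z} \<subseteq> range (\<lambda>k. rot3 p k x)"
proof (cases "cross2 y z = 0 \<or> cross2 z x = 0 \<or> cross2 x y = 0")
  case True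
  then consider "y = - z" | "z = - x" | "x = - y"
    using cross2_eq_0_imp_antipodal[of y z] cross2_eq_0_imp_antipodal[of z x]
      cross2_eq_0_imp_antipodal[of x y] unit distinct plane by blast
  then have "right_angled_triangle {x, y, z}"
  proof cases
    case 1
    then show ?thesis
      using antipodal_imp_right_angled_triangle[of x z] unit distinct by (simp add: insert_commute)
  next
    case 2
    then show ?thesis
      using antipodal_imp_right_angled_triangle[of y x] unit distinct by (simp add: insert_commute)
  next
    case 3
    then show ?thesis
      using antipodal_imp_right_angled_triangle[of z y] unit distinct by (simp add: insert_commute)
  qed
  then show ?thesis ..
next
  case False
  obtain n \<alpha> \<rho> v where act: "orth_action p \<alpha> n \<rho>" and orb: "emb3 ` {x, y, z} \<subseteq> orbit_n p \<alpha> n \<rho> v"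
    using toral unfolding spherical_sub_p_toral_def by blast
  have "\<exists>i. emb3 x i \<noteq> 0"
  proof (rule ccontr)
    assume "\<nexists>i. emb3 x i \<noteq> 0"
    then have "ip 3 (emb3 x) (emb3 x) = 0"
      by (simp add: ip_def)
    then show False
      using unit(1) by (simp add: ip_emb3)
  qed
  then obtain i where i: "emb3 x i \<noteq> 0" ..
  let ?u = "\<lambda>s. cis (2 * pi * real s / real p)"
  obtain s t where st: "s < p" "t < p"
    and rel: "of_real (cross2 y z) + of_real (cross2 z x) * ?u s + of_real (cross2 x y) * ?u t = 0"
    using orbit_relation_imp_root_relation[OF p act orb[simplified image_insert image_empty], of i
        "cross2 y z" "cross2 z x" "cross2 x y"] i cross2_relation[OF plane] by blast
  have x0: "planar x \<noteq> 0"
    using norm_planar[OF plane(1)] unit(1) by force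
  \<comment> \<open>Divided by \<open>planar x\<close>, this relation has the same real coefficients
    as \<open>rel\<close>, so the rigidity of the triangle compares the quotients with the roots of
    unity.\<close>
  have "of_real (cross2 y z) * planar x + of_real (cross2 z x) * planar y + of_real (cross2 x y) * planar z = 0"
    by (simp add: complex_eq_iff cross2_def algebra_simps)
  then have "of_real (cross2 y z) + of_real (cross2 z x) * (planar y / planar x)
      + of_real (cross2 x y) * (planar z / planar x) = 0"
    using x0 by (simp add: field_simps)
  then have "planar y / planar x = ?u s \<and> planar z / planar x = ?u t \<or>
      planar y / planar x = cnj (?u s) \<and> planar z / planar x = cnj (?u t)"
    using False rel unit plane
    by (intro unit_triangle_relation_unique[of "cross2 y z" "cross2 z x" "cross2 x y"])
      (simp_all add: norm_divide norm_planar)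
  then have "\<exists>k l. planar y / planar x = ?u k \<and> planar z / planar x = ?u l"
    unfolding cis_2pi_complement[OF st(1), symmetric] cis_2pi_complement[OF st(2), symmetric] by blast
  then obtain k l where "planar y = ?u k * planar x" "planar z = ?u l * planar x"
    using x0 by (auto simp: divide_eq_eq)
  then have "planar y = planar (rot3 p k x)" "planar z = planar (rot3 p l x)"
    by (simp_all only: planar_rot3)
  then have "y = rot3 p k x" "z = rot3 p l x"
    using plane planar_eq_iff[of y "rot3 p k x"] planar_eq_iff[of z "rot3 p l x"]
    unfolding rot3_nth(3) by blast+
  moreover have "x = rot3 p 0 x"
    by (simp add: vec_eq_iff forall_3)
  ultimately have "{x, y, z} \<subseteq> range (\<lambda>k. rot3 p k x)" by blast
  then show ?thesis ..
qed

text \<open>An orbit containing \<open>X\<close> can be based at any point of \<open>X\<close>,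
  which is why \<open>v\<close> ranges over \<open>X\<close> in the second part.\<close>

theorem theorem8:
  fixes X :: "(real^3) set"
  assumes "card X = 3" and "X \<subseteq> sphere 0 1"
  shows "(0 \<notin> affine hull X \<longrightarrow>
            (\<exists>N. \<forall>p. prime p \<and> p \<ge> N \<longrightarrow> spherical_sub_p_toral p 3 (emb3 ` X)))
       \<and> ((\<forall>x\<in>X. x$3 = 0) \<longrightarrow>
            ((\<exists>p. prime p \<and> spherical_sub_p_toral p 3 (emb3 ` X)) \<longleftrightarrow>
             (right_angled_triangle X \<or>
              (\<exists>p. prime p \<and> (\<exists>v\<in>X. X \<subseteq> range (\<lambda>k. rot3 p k v))))))"
proof -
  obtain x y z where X: "X = {x, y, z}" and distinct: "x \<noteq> y" "y \<noteq> z" "x \<noteq> z"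
    using assms(1) by (auto simp: card_3_iff)
  have unit: "norm x = 1" "norm y = 1" "norm z = 1"
    using assms(2) X by auto
  show ?thesis
  proof (intro conjI impI iffI)
    assume "0 \<notin> affine hull X"
    then have "(x \<bullet> y, y \<bullet> z, x \<bullet> z) \<in> elliptope_interior"
      using unit distinct by (intro gram_in_elliptope_interior) (auto simp: X)
    then obtain N where N: "\<And>p. p \<ge> N \<Longrightarrow> p > 0 \<Longrightarrow> (x \<bullet> y, y \<bullet> z, x \<bullet> z) \<in> convex hull (circle_grams p)"
      using elliptope_interior_eventually_circle_grams by blast
    have "spherical_sub_p_toral p 3 (emb3 ` X)" if "prime p \<and> p \<ge> N" for p
      unfolding X using that N[of p] unit prime_ge_2_nat[of p] prime_gt_0_nat[of p]
      by (intro spherical_sub_p_toral_emb3) auto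
    then show "\<exists>N. \<forall>p. prime p \<and> p \<ge> N \<longrightarrow> spherical_sub_p_toral p 3 (emb3 ` X)"
      by blast
  next
    assume plane: "\<forall>x\<in>X. x$3 = 0"
    assume "\<exists>p. prime p \<and> spherical_sub_p_toral p 3 (emb3 ` X)"
    then obtain p where p: "prime p" "spherical_sub_p_toral p 3 (emb3 ` X)" by blast
    then have "right_angled_triangle X \<or> X \<subseteq> range (\<lambda>k. rot3 p k x)"
      using plane unit distinct prime_gt_0_nat[of p] unfolding X by (intro planar_toral_cases) auto
    then show "right_angled_triangle X \<or> (\<exists>p. prime p \<and> (\<exists>v\<in>X. X \<subseteq> range (\<lambda>k. rot3 p k v)))"
      using p(1) X by blast
  next
    assume plane: "\<forall>x\<in>X. x$3 = 0"
    assume "right_angled_triangle X \<or> (\<exists>p. prime p \<and> (\<exists>v\<in>X. X \<subseteq> range (\<lambda>k. rot3 p k v)))"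
    then show "\<exists>p. prime p \<and> spherical_sub_p_toral p 3 (emb3 ` X)"
    proof
      assume "right_angled_triangle X"
      then show ?thesis
        using right_angled_triangle_toral[OF assms(2)] two_is_prime_nat by blast
    next
      assume "\<exists>p. prime p \<and> (\<exists>v\<in>X. X \<subseteq> range (\<lambda>k. rot3 p k v))"
      then obtain p v where p: "prime p" and v: "v \<in> X" "X \<subseteq> range (\<lambda>k. rot3 p k v)" by blast
      have "norm v = 1" "v$3 = 0"
        using v(1) assms(2) plane by auto
      then have "spherical_sub_p_toral p 3 (emb3 ` X)"
        using rot3_orbit_toral[of p x y z v] prime_ge_2_nat[OF p] unit v(2) unfolding X by blast
      then show ?thesis
        using p by blast
    qed
  qed
qed

end
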